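(* Let $A=\{0,1,2,3\}$ and let $P_z,P_e$ be integers with $0\le P_z,P_e\le 9$ and $(P_z,P_e)\neq(9,9)$. Then the language-shift cellular automaton $K:A^{\mathbb{Z}^2}\to A^{\mathbb{Z}^2}$ with parameters $(P_z,P_e)$ is not surjective.
   Context: Let $A=\{0,1,2,3\}$ and let $P_z,P_e$ be integers with $0\le P_z\le 9$ and $0\le P_e\le 9$. For $x\in A^{\mathbb{Z}^2}$ and $(i,j)\in\mathbb{Z}^2$ put $$\Sigma_0(x)_{i,j}=\sum_{r=-1}^{1}\sum_{s=-1}^{1}\left\lfloor \frac{x_{(i+r,j+s)}}{2}\right\rfloor,\qquad \Sigma_1(x)_{i,j}=\sum_{r=-1}^{1}\sum_{s=-1}^{1}\left(x_{(i+r,j+s)}-2\left\lfloor \frac{x_{(i+r,j+s)}}{2}\right\rfloor\right).$$ (So $\Sigma_0$ counts the cells in state $2$ or $3$, and $\Sigma_1$ counts the cells in state $1$ or $3$, in the $3\times 3$ block centered at $(i,j)$, center included.) The language-shift cellular automaton $K$ with parameters $(P_z,P_e)$ is defined, at each $(i,j)\in\mathbb{Z}^2$, by: - if $x_{(i,j)}=0$: $K(x)_{(i,j)}=0$ if $\Sigma_0(x)_{i,j}<P_z$ and $\Sigma_1(x)_{i,j}<P_e$; $=1$ if $\Sigma_0(x)_{i,j}<P_z$ and $\Sigma_1(x)_{i,j}\ge P_e$; $=2$ if $\Sigma_0(x)_{i,j}\ge P_z$ and $\Sigma_1(x)_{i,j}<P_e$; $=3$ if $\Sigma_0(x)_{i,j}\ge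 P_z$ and $\Sigma_1(x)_{i,j}\ge P_e$; - if $x_{(i,j)}=1$: $K(x)_{(i,j)}=3$ if $\Sigma_0(x)_{i,j}\ge P_z$, and $=1$ otherwise; - if $x_{(i,j)}=2$: $K(x)_{(i,j)}=3$ if $\Sigma_1(x)_{i,j}\ge P_e$, and $=2$ otherwise; - if $x_{(i,j)}=3$: $K(x)_{(i,j)}=3$. *)

theory Defs
  imports Main "HOL-Library.FuncSet"
begin

type_synonym config = "int \<times> int \<Rightarrow> int"

definition A :: "int set" where
  "A = {0, 1, 2, 3}"

definition configs :: "config set" where
  "configs = UNIV \<rightarrow> A"

(* Integer division by 2 rounds towards minus infinity, so it is the floor of x/2. *)

definition Sigma0 :: "config \<Rightarrow> int \<times> int \<Rightarrow> int" where
  "Sigma0 x = (\<lambda>(i, j). \<Sum>r = -1..1. \<Sum>s = -1..1. x (i + r, j + s) div 2)"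

definition Sigma1 :: "config \<Rightarrow> int \<times> int \<Rightarrow> int" where
  "Sigma1 x = (\<lambda>(i, j). \<Sum>r = -1..1. \<Sum>s = -1..1.
     (x (i + r, j + s) - 2 * (x (i + r, j + s) div 2)))"

(* On configurations over A, the last branch is exactly the case of state 3. *)

definition language_shift :: "int \<Rightarrow> int \<Rightarrow> config \<Rightarrow> config" where
  "language_shift Pz Pe x = (\<lambda>p.
     if x p = 0 then
       (if Sigma0 x p < Pz \<and> Sigma1 x p < Pe then 0
        else if Sigma0 x p < Pz \<and> Sigma1 x p \<ge> Pe then 1
        else if Sigma0 x p \<ge> Pz \<and> Sigma1 x p < Pe then 2
        else 3)
     else if x p = 1 then (if Sigma0 x p \<ge> Pz then 3 else 1)
     else if x p = 2 then (if Sigma1 x p \<ge> Pe then 3 else 2)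
     else 3)"

lemma language_shift_maps_configs: "language_shift Pz Pe \<in> configs \<rightarrow> configs"
  by (auto simp: configs_def A_def language_shift_def)

end

theory Submission
  imports Defs
begin

text \<open>The two binary digits of a state evolve independently: each layer is a threshold automaton in
  which ones persist and a zero becomes a one iff its block contains at least \<open>P\<close> ones. For \<open>P \<le> 8\<close>
  such a layer cannot produce the indicator of a set \<open>S\<close> of exactly \<open>P\<close> cells surrounding a cell \<open>z\<close>:
  a cell born in \<open>S\<close> would need \<open>P\<close> ones among the other \<open>P - 1\<close> cells of \<open>S\<close>, so \<open>S\<close> is its own
  only candidate preimage, but there \<open>z\<close> becomes a one.\<close>

lemma threshold_growth_orphan:
  assumes "finite S" "S \<subseteq> N z" "z \<notin> S"
    and growth: "\<And>p. p \<in> S \<longleftrightarrow> p \<in> X \<or> card S \<le> card (X \<inter> N p)"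
  shows False
proof -
  have "X \<subseteq> S"
    using growth by blast
  have "S \<subseteq> X"
  proof
    fix p assume "p \<in> S"
    show "p \<in> X"
    proof (rule ccontr)
      assume "p \<notin> X"
      then have "X \<inter> N p \<subset> S"
        using \<open>X \<subseteq> S\<close> \<open>p \<in> S\<close> by blast
      then have "card (X \<inter> N p) < card S"
        using \<open>finite S\<close> by (rule psubset_card_mono[rotated])
      then show False
        using growth[of p] \<open>p \<in> S\<close> \<open>p \<notin> X\<close> by simp
    qed
  qed
  then have "X \<inter> N z = S"
    using \<open>X \<subseteq> S\<close> \<open>S \<subseteq> N z\<close> by blast
  then show False
    using growth[of z] \<open>z \<notin> S\<close> by simp
qed

definition block :: "int \<times> int \<Rightarrow> (int \<times> int) set" where
  "block p = {fst p - 1..fst p + 1} \<times> {snd p - 1..snd p + 1}"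

lemma sum_block:
  fixes f :: "int \<times> int \<Rightarrow> int"
  shows "(\<Sum>r = -1..1. \<Sum>s = -1..1. f (i + r, j + s)) = sum f (block (i, j))"
proof -
  have shift: "sum g {a - 1..a + 1} = (\<Sum>r = -1..1. g (a + r))" for g :: "int \<Rightarrow> int" and a :: int
    by (rule sum.reindex_bij_witness[of _ "\<lambda>r. a + r" "\<lambda>k. k - a"]) auto
  show ?thesis
    by (simp add: block_def shift sum.cartesian_product')
qed

text \<open>Used for both layers: it turns a sum of binary digits into the cardinality that
  \<open>threshold_growth_orphan\<close> compares with \<open>card S\<close>.\<close>

lemma sum_block_indicator:
  assumes "\<And>q. f q = (if q \<in> X then 1 else (0 :: int))"
  shows "(\<Sum>r = -1..1. \<Sum>s = -1..1. f (i + r, j + s)) = int (card (X \<inter> block (i, j)))"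
proof -
  have "sum f (block (i, j)) = (\<Sum>q\<in>block (i, j). if q \<in> X then 1 else 0)"
    using assms by simp
  also have "\<dots> = int (card (block (i, j) \<inter> X))"
    by (subst sum.inter_restrict[symmetric]) (auto simp: block_def)
  finally show ?thesis
    by (simp only: sum_block Int_commute)
qed

lemma Sigma0_eq_card:
  assumes "x \<in> configs"
  shows "Sigma0 x p = int (card ({q. 2 \<le> x q} \<inter> block p))"
proof -
  \<comment> \<open>For a state in \<open>A\<close>, halving extracts the high binary digit, which
    is one exactly in states 2 and 3.\<close>
  have "x q div 2 = (if q \<in> {q. 2 \<le> x q} then 1 else 0)" for q
  proof -
    have "x q \<in> A" using assms by (auto simp: configs_def)
    then show ?thesis by (auto simp: A_def)
  qed
  from sum_block_indicator[OF this] show ?thesis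
    by (cases p) (simp only: Sigma0_def split)
qed

lemma Sigma1_eq_card:
  assumes "x \<in> configs"
  shows "Sigma1 x p = int (card ({q. odd (x q)} \<inter> block p))"
proof -
  have "x q - 2 * (x q div 2) = (if q \<in> {q. odd (x q)} then 1 else 0)" for q
    by (simp add: minus_mult_div_eq_mod odd_iff_mod_2_eq_one)
  from sum_block_indicator[OF this] show ?thesis
    by (cases p) (simp only: Sigma1_def split)
qed

text \<open>The four cases of the rule decouple: the new high digit depends only on the old high
  digits, through \<open>Sigma0\<close>. The next lemma is the analogue for the low digit, read off
  as parity.\<close>

lemma language_shift_ge_2_iff:
  assumes "x \<in> configs"
  shows "2 \<le> language_shift Pz Pe x p \<longleftrightarrow> 2 \<le> x p \<or> Pz \<le> Sigma0 x p"
proof -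
  have "x p \<in> A" using assms by (auto simp: configs_def)
  then show ?thesis by (auto simp: A_def language_shift_def)
qed

lemma odd_language_shift_iff:
  assumes "x \<in> configs"
  shows "odd (language_shift Pz Pe x p) \<longleftrightarrow> odd (x p) \<or> Pe \<le> Sigma1 x p"
proof -
  have "x p \<in> A" using assms by (auto simp: configs_def)
  then show ?thesis by (auto simp: A_def language_shift_def)
qed

text \<open>Removing the centre from a 3 by 3 block leaves eight cells, which is where the bound 8
  comes from. For \<open>P = 0\<close> the set is empty.\<close>

lemma punctured_block_subset:
  assumes "0 \<le> P" "P \<le> 8"
  obtains S where "finite S" "S \<subseteq> block z" "z \<notin> S" "int (card S) = P"
proof -
  have "card (block z - {z}) = 8"
    by (cases z) (simp add: block_def card_cartesian_product)
  then obtain S where "S \<subseteq> block z - {z}" "card S = nat P" "finite S"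
    using assms by (metis obtain_subset_with_card_n nat_le_iff of_nat_numeral)
  then show thesis
    using assms that[of S] by auto
qed

theorem proposition5:
  fixes Pz Pe :: int
  assumes "0 \<le> Pz" and "Pz \<le> 9" and "0 \<le> Pe" and "Pe \<le> 9"
    and "(Pz, Pe) \<noteq> (9, 9)"
  shows "\<not> language_shift Pz Pe ` configs = configs"
proof
  assume surj: "language_shift Pz Pe ` configs = configs"
  \<comment> \<open>Some layer has threshold at most 8, and an orphan in that one layer already
    rules out surjectivity.\<close>
  consider "Pz \<le> 8" | "Pe \<le> 8"
    using assms by fastforce
  then show False
  proof cases
    case 1
    then obtain S where S: "finite S" "S \<subseteq> block (0, 0)" "(0, 0) \<notin> S" "int (card S) = Pz"
      using punctured_block_subset assms(1) by blast
    \<comment> \<open>State 2 has high digit one and low digit zero, so the high layer of this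
      configuration is the indicator of \<open>S\<close>.\<close>
    have "(\<lambda>p. if p \<in> S then 2 else 0) \<in> configs"
      by (simp add: configs_def A_def)
    then obtain x where x: "x \<in> configs"
      and eq: "language_shift Pz Pe x = (\<lambda>p. if p \<in> S then 2 else 0)"
      using surj by (metis imageE)
    \<comment> \<open>The high layer of the preimage \<open>x\<close> plays the part of
      \<open>X\<close>, with \<open>Pz\<close> written as \<open>card S\<close>.\<close>
    have "p \<in> S \<longleftrightarrow> p \<in> {q. 2 \<le> x q} \<or> card S \<le> card ({q. 2 \<le> x q} \<inter> block p)" for p
      using language_shift_ge_2_iff[OF x, of Pz Pe p] Sigma0_eq_card[OF x, of p] S(4)
      by (auto simp: eq split: if_splits)
    from threshold_growth_orphan[OF S(1-3) this] show False .
  next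
    case 2
    then obtain S where S: "finite S" "S \<subseteq> block (0, 0)" "(0, 0) \<notin> S" "int (card S) = Pe"
      using punctured_block_subset assms(3) by blast
    \<comment> \<open>State 1 now puts the indicator of \<open>S\<close> into the low layer.\<close>
    have "(\<lambda>p. if p \<in> S then 1 else 0) \<in> configs"
      by (simp add: configs_def A_def)
    then obtain x where x: "x \<in> configs"
      and eq: "language_shift Pz Pe x = (\<lambda>p. if p \<in> S then 1 else 0)"
      using surj by (metis imageE)
    have "p \<in> S \<longleftrightarrow> p \<in> {q. odd (x q)} \<or> card S \<le> card ({q. odd (x q)} \<inter> block p)" for p
      using odd_language_shift_iff[OF x, of Pz Pe p] Sigma1_eq_card[OF x, of p] S(4)
      by (auto simp: eq split: if_splits)
    from threshold_growth_orphan[OF S(1-3) this] show False .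
  qed
qed

end
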